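(* For any nonempty subsets $A,B\subseteq S(n)$, $$\log|M|\ \ge\ \tfrac12\log|A|+\tfrac12\log|B|,$$ where $M$ is the midpoint set of $A$ and $B$.
   Context: $S(n)$ is the symmetric group on $\{1,\dots,n\}$, equipped with the graph distance $\mathrm{d}$ of its Cayley graph generated by all transpositions ($\{a,b\}$ is an edge iff $a^{-1}b$ is a transposition); equivalently $\mathrm{d}(a,b)=n-(\text{number of cycles of }a^{-1}b)$. A permutation $m$ is a midpoint of $a$ and $b$ if $\mathrm{d}(a,m)+\mathrm{d}(m,b)=\mathrm{d}(a,b)$ and $\mathrm{d}(a,m)-\mathrm{d}(m,b)\in\{-1,0,1\}$. The midpoint set of $A$ and $B$ is $M=\{m\in S(n): m\text{ is a midpoint of some }a\in A\text{ and }b\in B\}$. $|\cdot|$ denotes cardinality. *)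

theory Defs
  imports Complex_Main "HOL-Algebra.Sym_Groups"
begin

definition cayley_edges :: "nat \<Rightarrow> ((nat \<Rightarrow> nat) \<times> (nat \<Rightarrow> nat)) set" where
  "cayley_edges n = {(a, b). a \<in> carrier (sym_group n) \<and> b \<in> carrier (sym_group n) \<and>
     (\<exists>i\<in>{1..n}. \<exists>j\<in>{1..n}. i \<noteq> j \<and>
        inv\<^bsub>sym_group n\<^esub> a \<otimes>\<^bsub>sym_group n\<^esub> b = Transposition.transpose i j)}"

text \<open>
  A pair belongs to the \<open>k\<close>-th relational power of the edge relation iff it is joined by a walk of
  length \<open>k\<close>. Such a \<open>k\<close> exists for all \<open>a\<close>, \<open>b\<close> in the symmetric group; see
  \<open>cayley_edges_connected\<close> below.
\<close>
definition cayley_dist :: "nat \<Rightarrow> (nat \<Rightarrow> nat) \<Rightarrow> (nat \<Rightarrow> nat) \<Rightarrow> nat" where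
  "cayley_dist n a b = (LEAST k. (a, b) \<in> cayley_edges n ^^ k)"

definition is_midpoint :: "nat \<Rightarrow> (nat \<Rightarrow> nat) \<Rightarrow> (nat \<Rightarrow> nat) \<Rightarrow> (nat \<Rightarrow> nat) \<Rightarrow> bool" where
  "is_midpoint n a b m \<longleftrightarrow>
     cayley_dist n a m + cayley_dist n m b = cayley_dist n a b \<and>
     int (cayley_dist n a m) - int (cayley_dist n m b) \<in> {-1, 0, 1}"

definition midpoint_set ::
  "nat \<Rightarrow> (nat \<Rightarrow> nat) set \<Rightarrow> (nat \<Rightarrow> nat) set \<Rightarrow> (nat \<Rightarrow> nat) set" where
  "midpoint_set n A B = {m \<in> carrier (sym_group n). \<exists>a\<in>A. \<exists>b\<in>B. is_midpoint n a b m}"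

lemma cayley_edges_transpose:
  assumes a: "a permutes {1..n}" and ij: "i \<in> {1..n}" "j \<in> {1..n}" "i \<noteq> j"
  shows "(a, a \<circ> transpose i j) \<in> cayley_edges n"
proof -
  have a': "a \<in> carrier (sym_group n)"
    using a by (simp add: sym_group_carrier)
  have t: "transpose i j \<in> carrier (sym_group n)"
    using ij by (simp add: sym_group_carrier permutes_swap_id)
  interpret group "sym_group n" by (rule sym_group_is_group)
  have "inv\<^bsub>sym_group n\<^esub> a \<otimes>\<^bsub>sym_group n\<^esub> (a \<otimes>\<^bsub>sym_group n\<^esub> transpose i j) = transpose i j"
    using a' t by (simp add: m_assoc [symmetric] del: sym_group_inv_equality)
  moreover have "a \<otimes>\<^bsub>sym_group n\<^esub> transpose i j \<in> carrier (sym_group n)"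
    using a' t by simp
  ultimately show ?thesis
    using a' ij unfolding cayley_edges_def sym_group_mult by blast
qed

lemma cayley_edges_connected:
  assumes "a \<in> carrier (sym_group n)" "b \<in> carrier (sym_group n)"
  shows "\<exists>k. (a, b) \<in> cayley_edges n ^^ k"
proof -
  have *: "\<forall>a. a permutes {1..n} \<longrightarrow> (a, a \<circ> p) \<in> (cayley_edges n)\<^sup>*" if "p permutes {1..n}" for p
    using finite_atLeastAtMost that
  proof (induction rule: permutes_rev_induct)
    case id
    then show ?case by simp
  next
    case (swap i j p)
    show ?case
    proof (intro allI impI)
      fix a assume a: "a permutes {1..n}"
      have 1: "(a, a \<circ> p) \<in> (cayley_edges n)\<^sup>*" using swap a by blast
      have ap: "a \<circ> p permutes {1..n}" using swap a by (blast intro: permutes_compose)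
      show "(a, a \<circ> (p \<circ> transpose i j)) \<in> (cayley_edges n)\<^sup>*"
      proof (cases "i = j")
        case False
        have "(a \<circ> p, a \<circ> p \<circ> transpose i j) \<in> cayley_edges n"
          using cayley_edges_transpose [OF ap] swap False by blast
        then show ?thesis using 1 by (simp add: comp_assoc)
      qed (use 1 in simp)
    qed
  qed
  have ab: "a permutes {1..n}" "b permutes {1..n}"
    using assms by (simp_all add: sym_group_carrier)
  have "inv' a \<circ> b permutes {1..n}"
    using ab by (blast intro: permutes_compose permutes_inv)
  then have "(a, a \<circ> (inv' a \<circ> b)) \<in> (cayley_edges n)\<^sup>*"
    using * ab by blast
  moreover have "a \<circ> (inv' a \<circ> b) = b"
    using permutes_inv_o(1) [OF ab(1)] by (simp add: comp_assoc [symmetric])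
  ultimately show ?thesis
    by (simp add: rtrancl_power)
qed

end

theory Submission
  imports Defs
begin

text \<open>
  Every permutation factors uniquely as \<open>t\<^sub>r \<circ> \<dots> \<circ> t\<^sub>1\<close> with transpositions \<open>t\<^sub>k = (i\<^sub>k j\<^sub>k)\<close>, \<open>i\<^sub>k < j\<^sub>k\<close>
  and \<open>j\<^sub>1 < \<dots> < j\<^sub>r\<close>, and \<open>r\<close> is its distance to the identity. Given \<open>a\<close>, \<open>b\<close>, write the
  factorization of \<open>c = a\<^sup>-\<^sup>1 b\<close> as \<open>k \<circ> p\<close>, where \<open>p\<close> consists of the \<open>r div 2\<close> rightmost factors.
  Both \<open>m = b p\<^sup>-\<^sup>1\<close> and \<open>m' = b k\<^sup>-\<^sup>1\<close> are midpoints of \<open>a\<close> and \<open>b\<close>, the second one by conjugation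
  invariance of the distance. The pair \<open>(m, m')\<close> determines \<open>m'\<^sup>-\<^sup>1 m = k \<circ> p\<^sup>-\<^sup>1\<close>, which has the
  same length \<open>r\<close> as \<open>c\<close>; the factors of \<open>k\<close> can be read off it one at a time, starting from the
  largest moved point, and what remains is \<open>p\<^sup>-\<^sup>1\<close>. So \<open>(m, m')\<close> determines \<open>c\<close>, hence \<open>p\<close>, \<open>b\<close> and
  \<open>a\<close>, and \<open>A \<times> B\<close> injects into \<open>M \<times> M\<close>.
\<close>

section \<open>Canonical factorization and its length\<close>

definition peel :: "nat \<Rightarrow> (nat \<Rightarrow> nat) \<Rightarrow> nat \<Rightarrow> nat" where
  "peel k c = transpose k (c k) \<circ> c"

text \<open>On permutations of \<open>{1..n}\<close> this is \<open>n\<close> minus the number of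
  cycles. The recursive form suits inductions that split off the factor moving the largest
  point.\<close>

primrec perm_rank :: "nat \<Rightarrow> (nat \<Rightarrow> nat) \<Rightarrow> nat" where
  "perm_rank 0 c = 0"
| "perm_rank (Suc n) c = (if c (Suc n) = Suc n then 0 else 1) + perm_rank n (peel (Suc n) c)"

text \<open>Words of arbitrary, not necessarily minimal, length: the link between walks in the
  Cayley graph and the rank.\<close>

inductive transposition_word :: "nat \<Rightarrow> nat \<Rightarrow> (nat \<Rightarrow> nat) \<Rightarrow> bool" for n where
  Nil: "transposition_word n 0 id"
| Cons: "transposition_word n (Suc k) (transpose p q \<circ> c)"
    if "transposition_word n k c" "p \<in> {1..n}" "q \<in> {1..n}" "p \<noteq> q"

lemma permutes_top_in:
  assumes "c permutes {1..Suc n}"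
  shows "c (Suc n) \<in> {1..Suc n}"
  unfolding permutes_in_image[OF assms] by simp

lemma peel_permutes:
  assumes "c permutes {1..Suc n}"
  shows "peel (Suc n) c permutes {1..n}"
proof -
  have "c (Suc n) \<in> {1..Suc n}"
    by (rule permutes_top_in[OF assms])
  then have *: "peel (Suc n) c permutes {1..Suc n}"
    unfolding peel_def by (intro permutes_compose[OF assms] permutes_swap_id) auto
  have "peel (Suc n) c x = x" if "x \<in> {1..Suc n} - {1..n}" for x
  proof -
    have "x = Suc n" using that by auto
    then show ?thesis by (simp add: peel_def)
  qed
  then show ?thesis using permutes_superset[OF *] by blast
qed

lemma peel_inverse: "transpose k (c k) \<circ> peel k c = c"
  by (simp add: peel_def comp_assoc[symmetric])

lemma peel_fixed: "c k = k \<Longrightarrow> peel k c = c"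
  by (simp add: peel_def)

lemma peel_transpose_comp:
  assumes "c k = k"
  shows "peel k (transpose k i \<circ> c) = c"
  using assms by (simp add: peel_def comp_assoc[symmetric])

lemma permutes_Suc: "c permutes {1..n} \<Longrightarrow> c permutes {1..Suc n}"
  by (rule permutes_subset) auto

lemma permutes_fixes_Suc: "c permutes {1..n} \<Longrightarrow> c (Suc n) = Suc n"
  by (rule permutes_not_in) auto

lemma perm_rank_Suc:
  "c permutes {1..n} \<Longrightarrow> perm_rank (Suc n) c = perm_rank n c"
  by (simp add: permutes_fixes_Suc peel_fixed)

lemma perm_rank_Suc_transpose:
  assumes "c permutes {1..n}" "i \<noteq> Suc n"
  shows "perm_rank (Suc n) (transpose (Suc n) i \<circ> c) = Suc (perm_rank n c)"
  using assms by (simp add: peel_transpose_comp permutes_fixes_Suc)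

lemma perm_rank_id: "perm_rank n id = 0"
  by (induction n) (simp_all add: peel_fixed)

text \<open>The new transposition is pushed through the top factor of \<open>c\<close>. It creates
  that factor, cancels it, or passes it, possibly conjugated, and then the induction hypothesis
  applies to \<open>peel\<close>.\<close>

lemma perm_rank_transpose_le:
  assumes "c permutes {1..n}" "p \<in> {1..n}" "q \<in> {1..n}"
  shows "perm_rank n (transpose p q \<circ> c) \<le> Suc (perm_rank n c)"
  using assms
proof (induction n arbitrary: c p q)
  case 0
  then show ?case by simp
next
  case (Suc n)
  let ?N = "Suc n"
  let ?r = "peel ?N c"
  have r: "?r permutes {1..n}" by (rule peel_permutes[OF Suc.prems(1)])
  have cN: "c ?N \<in> {1..?N}" by (rule permutes_top_in[OF Suc.prems(1)])
  have top: "perm_rank ?N (transpose p ?N \<circ> c) \<le> Suc (perm_rank ?N c)"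
    if p: "p \<in> {1..n}" for p
  proof -
    consider "c ?N = ?N" | "c ?N = p" | "c ?N \<noteq> ?N" "c ?N \<noteq> p" by blast
    then show ?thesis
    proof cases
      case 1
      then show ?thesis using p
        by (simp add: peel_transpose_comp peel_fixed transpose_commute[of p])
    next
      case 2
      then have "peel ?N (transpose p ?N \<circ> c) = ?r"
        by (simp add: peel_def transpose_commute[of p])
      then show ?thesis using p 2 by simp
    next
      case 3
      have "peel ?N (transpose p ?N \<circ> c) = transpose ?N (c ?N) \<circ> transpose p ?N \<circ> c"
        using 3 by (simp add: peel_def comp_assoc)
      also have "\<dots> = transpose ?N (c ?N) \<circ> transpose p ?N \<circ> transpose ?N (c ?N) \<circ> ?r"
        by (metis comp_assoc peel_inverse)
      \<comment> \<open>Conjugation by the top factor sends \<open>?N\<close> to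
        \<open>c ?N\<close>, so the transposition no longer moves the top point and acts inside
        \<open>{1..n}\<close>.\<close>
      also have "transpose ?N (c ?N) \<circ> transpose p ?N \<circ> transpose ?N (c ?N) = transpose p (c ?N)"
        using 3 p by (auto simp: fun_eq_iff transpose_def)
      finally have "peel ?N (transpose p ?N \<circ> c) = transpose p (c ?N) \<circ> ?r" .
      moreover have "perm_rank n (transpose p (c ?N) \<circ> ?r) \<le> Suc (perm_rank n ?r)"
        using 3 cN by (intro Suc.IH[OF r p]) auto
      ultimately show ?thesis using 3 by simp
    qed
  qed
  consider "p = q" | "p \<noteq> q" "p = ?N" | "p \<noteq> q" "q = ?N" | "p \<noteq> ?N" "q \<noteq> ?N" by blast
  then show ?case
  proof cases
    case 1
    then show ?thesis by simp
  next
    case 2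
    then have "perm_rank ?N (transpose q ?N \<circ> c) \<le> Suc (perm_rank ?N c)"
      using Suc.prems by (intro top) auto
    then show ?thesis using 2 transpose_commute by metis
  next
    case 3
    then have "perm_rank ?N (transpose p ?N \<circ> c) \<le> Suc (perm_rank ?N c)"
      using Suc.prems by (intro top) auto
    then show ?thesis using 3 by metis
  next
    case 4
    then have pq: "p \<in> {1..n}" "q \<in> {1..n}" using Suc.prems by auto
    have "peel ?N (transpose p q \<circ> c) = transpose p q \<circ> ?r"
      using 4 by (auto simp: peel_def fun_eq_iff transpose_def)
    moreover have "transpose p q (c ?N) = ?N \<longleftrightarrow> c ?N = ?N"
      using 4 by (auto simp: transpose_def)
    ultimately have "perm_rank ?N (transpose p q \<circ> c) =
        (if c ?N = ?N then 0 else 1) + perm_rank n (transpose p q \<circ> ?r)" by simp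
    also have "\<dots> \<le> (if c ?N = ?N then 0 else 1) + Suc (perm_rank n ?r)"
      using Suc.IH[OF r pq] by (rule add_left_mono)
    also have "\<dots> = Suc (perm_rank ?N c)" by simp
    finally show ?thesis .
  qed
qed

section \<open>The rank as minimal word length, and its invariances\<close>

lemma transposition_word_permutes:
  "transposition_word n k c \<Longrightarrow> c permutes {1..n}"
  by (induction rule: transposition_word.induct)
    (intro permutes_id permutes_compose permutes_swap_id; assumption)+

lemma perm_rank_le:
  "transposition_word n k c \<Longrightarrow> perm_rank n c \<le> k"
proof (induction rule: transposition_word.induct)
  case (Cons k c p q)
  have "perm_rank n (transpose p q \<circ> c) \<le> Suc (perm_rank n c)"
    using Cons by (intro perm_rank_transpose_le transposition_word_permutes)
  also have "\<dots> \<le> Suc k" using Cons.IH by simp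
  finally show ?case .
next
  case Nil
  show ?case using perm_rank_id le0 by metis
qed

lemma transposition_word_Suc:
  "transposition_word n k c \<Longrightarrow> transposition_word (Suc n) k c"
proof (induction rule: transposition_word.induct)
  case Nil
  show ?case by (rule transposition_word.Nil)
next
  case (Cons k c p q)
  show ?case by (rule transposition_word.Cons[OF Cons.IH]) (use Cons in auto)
qed

text \<open>The canonical factorization is itself a word, so the lower bound
  \<open>perm_rank_le\<close> is attained. Closure properties of words thereby become facts about
  the rank.\<close>

lemma transposition_word_rank:
  "c permutes {1..n} \<Longrightarrow> transposition_word n (perm_rank n c) c"
proof (induction n arbitrary: c)
  case 0
  then have "c = id" by simp
  then show ?case using transposition_word.Nil perm_rank.simps(1) by metis
next
  case (Suc n)
  have w: "transposition_word (Suc n) (perm_rank n (peel (Suc n) c)) (peel (Suc n) c)"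
    using Suc by (intro transposition_word_Suc Suc.IH peel_permutes)
  have "c (Suc n) \<in> {1..Suc n}" by (rule permutes_top_in[OF Suc.prems])
  then show ?case
    using w transposition_word.Cons[OF w, of "Suc n" "c (Suc n)"]
    by (auto simp: peel_inverse peel_fixed)
qed

lemma transposition_word_comp:
  assumes "transposition_word n k c" "transposition_word n l d"
  shows "transposition_word n (k + l) (c \<circ> d)"
  using assms(1)
proof (induction rule: transposition_word.induct)
  case Nil
  show ?case using assms(2) by simp
next
  case (Cons k c p q)
  show ?case
    using transposition_word.Cons[OF Cons.IH Cons(2-4)] unfolding comp_assoc add_Suc .
qed

lemma transposition_word_inv:
  assumes "transposition_word n k c"
  shows "transposition_word n k (inv' c)"
  using assms
proof (induction rule: transposition_word.induct)
  case Nil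
  show ?case unfolding inv_id by (rule transposition_word.Nil)
next
  case (Cons k c p q)
  have "transposition_word n 1 (transpose p q)"
    using transposition_word.Cons[OF transposition_word.Nil Cons(2-4)] by simp
  from transposition_word_comp[OF Cons.IH this]
  have "transposition_word n (Suc k) (inv' c \<circ> transpose p q)" by simp
  moreover have "inv' (transpose p q \<circ> c) = inv' c \<circ> transpose p q"
    using permutes_bij[OF transposition_word_permutes[OF Cons(1)]]
    by (simp add: o_inv_distrib)
  ultimately show ?case by metis
qed

text \<open>Conjugation turns each factor \<open>transpose p q\<close> into
  \<open>transpose (g p) (g q)\<close>, leaving the number of factors unchanged.\<close>

lemma transposition_word_conj:
  assumes "transposition_word n k c" and g: "g permutes {1..n}"
  shows "transposition_word n k (g \<circ> c \<circ> inv' g)"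
  using assms(1)
proof (induction rule: transposition_word.induct)
  case Nil
  have "g \<circ> id \<circ> inv' g = id" using g by (simp add: permutes_inv_o)
  then show ?case using transposition_word.Nil by metis
next
  case (Cons k c p q)
  have "g \<circ> (transpose p q \<circ> c) \<circ> inv' g = transpose (g p) (g q) \<circ> (g \<circ> c \<circ> inv' g)"
    using permutes_inj[OF g] by (auto simp: fun_eq_iff transpose_def inj_eq)
  moreover have "g p \<in> {1..n}" "g q \<in> {1..n}" "g p \<noteq> g q"
    using Cons(2-4) permutes_in_image[OF g] permutes_inj[OF g] by (auto simp: inj_eq)
  ultimately show ?case using transposition_word.Cons[OF Cons.IH] by metis
qed

lemma perm_rank_comp_le:
  assumes "c permutes {1..n}" "d permutes {1..n}"
  shows "perm_rank n (c \<circ> d) \<le> perm_rank n c + perm_rank n d"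
  using assms by (intro perm_rank_le transposition_word_comp transposition_word_rank)

lemma perm_rank_inv:
  assumes "c permutes {1..n}"
  shows "perm_rank n (inv' c) = perm_rank n c"
proof (rule antisym)
  show le: "perm_rank n (inv' c) \<le> perm_rank n c"
    using assms by (intro perm_rank_le transposition_word_inv transposition_word_rank)
  have "perm_rank n (inv' (inv' c)) \<le> perm_rank n (inv' c)"
    using assms by (intro perm_rank_le transposition_word_inv transposition_word_rank permutes_inv)
  then show "perm_rank n c \<le> perm_rank n (inv' c)"
    using assms by (simp add: permutes_inv_inv)
qed

lemma perm_rank_conj:
  assumes c: "c permutes {1..n}" and g: "g permutes {1..n}"
  shows "perm_rank n (g \<circ> c \<circ> inv' g) = perm_rank n c"
proof -
  have le: "perm_rank n (g \<circ> c \<circ> inv' g) \<le> perm_rank n c"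
    if "c permutes {1..n}" "g permutes {1..n}" for c g
    using that by (intro perm_rank_le transposition_word_conj transposition_word_rank)
  \<comment> \<open>Conjugating back by \<open>inv' g\<close> turns the inequality \<open>le\<close>
    into its converse.\<close>
  have "inv' g \<circ> (g \<circ> c \<circ> inv' g) \<circ> inv' (inv' g) = c"
    using g by (simp add: fun_eq_iff permutes_inv_inv permutes_inverses)
  moreover have "g \<circ> c \<circ> inv' g permutes {1..n}"
    by (intro permutes_compose permutes_inv c g)
  ultimately show ?thesis
    using le[OF c g] le[of "g \<circ> c \<circ> inv' g" "inv' g"] permutes_inv[OF g] by simp
qed

subsection \<open>Distance and rank\<close>

text \<open>Edges multiply on the right, so the leftmost factor is the first step of the walk and
  the start vertex must vary in the induction.\<close>

lemma cayley_walk_of_word: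
  assumes "transposition_word n k c" "a permutes {1..n}"
  shows "(a, a \<circ> c) \<in> cayley_edges n ^^ k"
  using assms
proof (induction arbitrary: a rule: transposition_word.induct)
  case (Cons k c p q)
  have "a \<circ> transpose p q permutes {1..n}"
    using Cons by (intro permutes_compose permutes_swap_id) auto
  then have "(a \<circ> transpose p q, a \<circ> transpose p q \<circ> c) \<in> cayley_edges n ^^ k"
    by (rule Cons.IH)
  with cayley_edges_transpose[OF Cons.prems Cons(2-4)]
  have "(a, a \<circ> transpose p q \<circ> c) \<in> cayley_edges n ^^ Suc k"
    by (rule relpow_Suc_I2)
  then show ?case unfolding comp_assoc .
qed simp

lemma word_of_cayley_walk:
  assumes "(a, b) \<in> cayley_edges n ^^ k" "a permutes {1..n}"
  shows "transposition_word n k (inv' a \<circ> b)"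
  using assms
proof (induction k arbitrary: a)
  case 0
  then have "inv' a \<circ> b = id" by (simp add: permutes_inv_o)
  then show ?case using transposition_word.Nil by metis
next
  case (Suc k)
  from relpow_Suc_D2[OF Suc.prems(1)] obtain y where
    y: "(a, y) \<in> cayley_edges n" "(y, b) \<in> cayley_edges n ^^ k" by blast
  from y(1) obtain p q where pq: "p \<in> {1..n}" "q \<in> {1..n}" "p \<noteq> q"
    and t: "inv' a \<circ> y = transpose p q" and yp: "y permutes {1..n}"
    unfolding cayley_edges_def by (auto simp: sym_group_carrier sym_group_mult)
  have "inv' a \<circ> b = (inv' a \<circ> y) \<circ> (inv' y \<circ> b)"
    using yp by (simp add: fun_eq_iff permutes_inverses)
  then show ?case
    using transposition_word.Cons[OF Suc.IH[OF y(2) yp] pq] t by metis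
qed

lemma cayley_dist_eq_rank:
  assumes "a permutes {1..n}" "b permutes {1..n}"
  shows "cayley_dist n a b = perm_rank n (inv' a \<circ> b)"
  unfolding cayley_dist_def
proof (rule Least_equality)
  have "inv' a \<circ> b permutes {1..n}"
    using assms by (intro permutes_compose permutes_inv)
  from cayley_walk_of_word[OF transposition_word_rank[OF this] assms(1)]
  show "(a, b) \<in> cayley_edges n ^^ perm_rank n (inv' a \<circ> b)"
    using assms by (simp add: comp_assoc[symmetric] permutes_inv_o)
qed (use assms perm_rank_le word_of_cayley_walk in blast)

subsection \<open>Cutting the canonical factorization\<close>

text \<open>Left factors are peeled off until at most \<open>s\<close> remain. A peel lowers the
  rank by at most one, so exactly \<open>s\<close> remain whenever the rank was at least
  \<open>s\<close>.\<close>

primrec prefix :: "nat \<Rightarrow> nat \<Rightarrow> (nat \<Rightarrow> nat) \<Rightarrow> nat \<Rightarrow> nat" where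
  "prefix s 0 c = c"
| "prefix s (Suc n) c = (if perm_rank (Suc n) c \<le> s then c else prefix s n (peel (Suc n) c))"

lemma prefix_permutes:
  "c permutes {1..n} \<Longrightarrow> prefix s n c permutes {1..n}"
proof (induction n arbitrary: c)
  case (Suc n)
  then show ?case using permutes_Suc[OF Suc.IH[OF peel_permutes]] by auto
qed simp

lemma perm_rank_prefix:
  assumes "c permutes {1..n}" "s \<le> perm_rank n c"
  shows "perm_rank n (prefix s n c) = s"
  using assms
proof (induction n arbitrary: c)
  case (Suc n)
  note p = peel_permutes[OF Suc.prems(1)]
  show ?case
  proof (cases "perm_rank (Suc n) c \<le> s")
    case False
    then have "s \<le> perm_rank n (peel (Suc n) c)" by (auto split: if_splits)
    with False show ?thesis
      using Suc.IH[OF p] perm_rank_Suc[OF prefix_permutes[OF p]] by (simp del: perm_rank.simps)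
  qed (use Suc.prems in simp)
qed simp

text \<open>The factors peeled off form a word of the right length, which gives the upper bound; the
  lower bound is subadditivity of the rank.\<close>

lemma perm_rank_suffix:
  assumes "c permutes {1..n}" "s \<le> perm_rank n c"
  shows "perm_rank n (c \<circ> inv' (prefix s n c)) = perm_rank n c - s"
proof (rule antisym)
  let ?p = "prefix s n c"
  have p: "?p permutes {1..n}" by (rule prefix_permutes[OF assms(1)])
  show "perm_rank n (c \<circ> inv' ?p) \<le> perm_rank n c - s"
    using assms
  proof (induction n arbitrary: c)
    case (Suc n)
    let ?r = "peel (Suc n) c"
    note r = peel_permutes[OF Suc.prems(1)]
    show ?case
    proof (cases "perm_rank (Suc n) c \<le> s")
      case True
      then have "c \<circ> inv' (prefix s (Suc n) c) = id"
        using Suc.prems by (simp add: permutes_inv_o del: perm_rank.simps)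
      then show ?thesis using perm_rank_id le0 by metis
    next
      case False
      let ?d = "?r \<circ> inv' (prefix s n ?r)"
      have le: "s \<le> perm_rank n ?r" using False by (auto split: if_splits)
      have d: "?d permutes {1..n}"
        by (intro permutes_compose permutes_inv prefix_permutes r)
      have "c \<circ> inv' (prefix s (Suc n) c) = transpose (Suc n) (c (Suc n)) \<circ> ?d"
        using False by (simp del: perm_rank.simps add: comp_assoc[symmetric] peel_inverse)
      \<comment> \<open>When \<open>c (Suc n) = Suc n\<close> the transposition is the identity,
        whence the summand 0.\<close>
      moreover have "perm_rank (Suc n) (transpose (Suc n) (c (Suc n)) \<circ> ?d) =
          (if c (Suc n) = Suc n then 0 else 1) + perm_rank n ?d"
        using perm_rank_Suc[OF d] perm_rank_Suc_transpose[OF d, of "c (Suc n)"] by auto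
      ultimately have "perm_rank (Suc n) (c \<circ> inv' (prefix s (Suc n) c)) =
          (if c (Suc n) = Suc n then 0 else 1) + perm_rank n ?d"
        by metis
      also have "\<dots> \<le> (if c (Suc n) = Suc n then 0 else 1) + (perm_rank n ?r - s)"
        by (intro add_left_mono Suc.IH r le)
      also have "\<dots> = perm_rank (Suc n) c - s" using le by simp
      finally have "perm_rank (Suc n) (c \<circ> inv' (prefix s (Suc n) c)) \<le> perm_rank (Suc n) c - s" .
      then show ?thesis .
    qed
  qed simp
  have "c = (c \<circ> inv' ?p) \<circ> ?p" using p by (simp add: fun_eq_iff permutes_inverses)
  then have "perm_rank n c \<le> perm_rank n (c \<circ> inv' ?p) + perm_rank n ?p"
    using perm_rank_comp_le[of "c \<circ> inv' ?p" n ?p] assms(1) p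
    by (metis permutes_compose permutes_inv)
  then show "perm_rank n c - s \<le> perm_rank n (c \<circ> inv' ?p)"
    using perm_rank_prefix[OF assms] by simp
qed

text \<open>With \<open>c\<close> cut as \<open>k \<circ> p\<close>, where \<open>p\<close> is the
  prefix, this is \<open>k \<circ> inv' p\<close>, since \<open>c \<circ> inv' p\<close> is
  \<open>k\<close>.\<close>

definition invert_prefix :: "nat \<Rightarrow> nat \<Rightarrow> (nat \<Rightarrow> nat) \<Rightarrow> nat \<Rightarrow> nat" where
  "invert_prefix s n c = c \<circ> inv' (prefix s n c) \<circ> inv' (prefix s n c)"

lemma invert_prefix_permutes:
  "c permutes {1..n} \<Longrightarrow> invert_prefix s n c permutes {1..n}"
  unfolding invert_prefix_def by (intro permutes_compose permutes_inv prefix_permutes)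

lemma invert_prefix_low:
  assumes "c permutes {1..Suc n}" "perm_rank (Suc n) c \<le> s"
  shows "invert_prefix s (Suc n) c = inv' c"
  using assms by (simp add: invert_prefix_def permutes_inv_o del: perm_rank.simps)

lemma invert_prefix_high:
  assumes "\<not> perm_rank (Suc n) c \<le> s"
  shows "invert_prefix s (Suc n) c =
    transpose (Suc n) (c (Suc n)) \<circ> invert_prefix s n (peel (Suc n) c)"
  using assms
  by (simp add: invert_prefix_def comp_assoc[symmetric] peel_inverse del: perm_rank.simps)

text \<open>The factors above the cut survive unchanged, and inverting what lies below preserves its
  rank.\<close>

lemma perm_rank_invert_prefix:
  "c permutes {1..n} \<Longrightarrow> perm_rank n (invert_prefix s n c) = perm_rank n c"
proof (induction n arbitrary: c)
  case (Suc n)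
  note r = peel_permutes[OF Suc.prems]
  note f = invert_prefix_permutes[OF r, of s]
  show ?case
  proof (cases "perm_rank (Suc n) c \<le> s")
    case True
    then show ?thesis using Suc.prems invert_prefix_low perm_rank_inv by metis
  next
    case False
    show ?thesis
    proof (cases "c (Suc n) = Suc n")
      case True
      then show ?thesis
        using Suc.IH[OF r] perm_rank_Suc[OF f] invert_prefix_high[OF False] by simp
    next
      case ne: False
      have "perm_rank (Suc n) (invert_prefix s (Suc n) c) = Suc (perm_rank n (peel (Suc n) c))"
        using Suc.IH[OF r] perm_rank_Suc_transpose[OF f ne] invert_prefix_high[OF False] by metis
      then show ?thesis using ne by simp
    qed
  qed
qed simp

text \<open>Equal images have equal ranks, so the recursions for \<open>c\<close> and
  \<open>d\<close> stop at the same level. Above it the top factors are compared one by one; at the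
  stop only inversion has to be undone.\<close>

lemma invert_prefix_inj:
  assumes "c permutes {1..n}" "d permutes {1..n}" "invert_prefix s n c = invert_prefix s n d"
  shows "c = d"
  using assms
proof (induction n arbitrary: c d)
  case (Suc n)
  let ?N = "Suc n"
  have rank: "perm_rank ?N c = perm_rank ?N d"
    using Suc.prems perm_rank_invert_prefix by metis
  show ?case
  proof (cases "perm_rank ?N c \<le> s")
    case True
    then have "inv' c = inv' d" using Suc.prems rank invert_prefix_low by metis
    then show ?thesis using Suc.prems permutes_inv_inv by metis
  next
    case False
    let ?f = "\<lambda>c. invert_prefix s n (peel ?N c)"
    have fixed: "?f c ?N = ?N" "?f d ?N = ?N"
      by (intro permutes_fixes_Suc invert_prefix_permutes peel_permutes Suc.prems)+
    have eq: "transpose ?N (c ?N) \<circ> ?f c = transpose ?N (d ?N) \<circ> ?f d"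
      using False rank Suc.prems(3) invert_prefix_high by metis
    \<comment> \<open>Both remainders fix \<open>?N\<close>, so evaluating \<open>eq\<close> at
      \<open>?N\<close> reads off the top factor.\<close>
    then have "c ?N = d ?N" using fixed by (metis comp_apply transpose_apply_first)
    moreover have "?f c = ?f d"
      using eq fixed peel_transpose_comp by metis
    then have "peel ?N c = peel ?N d"
      by (rule Suc.IH[OF peel_permutes[OF Suc.prems(1)] peel_permutes[OF Suc.prems(2)]])
    ultimately show ?thesis using peel_inverse by metis
  qed
qed simp

subsection \<open>The injection\<close>

definition half_prefix :: "nat \<Rightarrow> (nat \<Rightarrow> nat) \<Rightarrow> nat \<Rightarrow> nat" where
  "half_prefix n c = prefix (perm_rank n c div 2) n c"

lemma inv_second_midpoint:
  assumes "b permutes S" "p permutes S" "c permutes S"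
  shows "inv' (b \<circ> p \<circ> inv' c) = c \<circ> inv' p \<circ> inv' b"
proof -
  have "bij b" "bij p" "bij (inv' c)" "inv' (inv' c) = c"
    using assms by (auto intro: permutes_bij permutes_inv simp: permutes_inv_inv)
  then show ?thesis by (simp add: o_inv_distrib bij_comp comp_assoc)
qed

definition midpoint_pair ::
  "nat \<Rightarrow> (nat \<Rightarrow> nat) \<times> (nat \<Rightarrow> nat) \<Rightarrow> (nat \<Rightarrow> nat) \<times> (nat \<Rightarrow> nat)" where
  "midpoint_pair n = (\<lambda>(a, b). let c = inv' a \<circ> b; p = half_prefix n c in
     (b \<circ> inv' p, b \<circ> p \<circ> inv' c))"

lemma half_prefix_permutes: "c permutes {1..n} \<Longrightarrow> half_prefix n c permutes {1..n}"
  unfolding half_prefix_def by (rule prefix_permutes)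

lemma midpoint_pair_in_midpoint_set:
  assumes "A \<subseteq> carrier (sym_group n)" "B \<subseteq> carrier (sym_group n)" "a \<in> A" "b \<in> B"
  shows "midpoint_pair n (a, b) \<in> midpoint_set n A B \<times> midpoint_set n A B"
proof -
  have a: "a permutes {1..n}" and b: "b permutes {1..n}"
    using assms by (auto simp: sym_group_carrier)
  define c where "c = inv' a \<circ> b"
  define p where "p = half_prefix n c"
  define r where "r = perm_rank n c"
  let ?k = "c \<circ> inv' p" and ?m = "b \<circ> inv' p" and ?m' = "b \<circ> p \<circ> inv' c"
  have c: "c permutes {1..n}" unfolding c_def by (intro permutes_compose permutes_inv a b)
  have p: "p permutes {1..n}" unfolding p_def by (rule half_prefix_permutes[OF c])
  have k: "?k permutes {1..n}" by (intro permutes_compose permutes_inv c p)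
  have m: "?m permutes {1..n}" and m': "?m' permutes {1..n}"
    by (intro permutes_compose permutes_inv b c p)+
  have rp: "perm_rank n p = r div 2" and rk: "perm_rank n ?k = r - r div 2"
    using c by (simp_all add: p_def half_prefix_def r_def perm_rank_prefix perm_rank_suffix)
  have inv_comp: "inv' (x \<circ> y) = inv' y \<circ> inv' x"
    if "x permutes {1..n}" "y permutes {1..n}" for x y
    using that by (intro o_inv_distrib permutes_bij)
  have inv_m: "inv' ?m = p \<circ> inv' b" and inv_m': "inv' ?m' = c \<circ> inv' p \<circ> inv' b"
    using b c p by (simp_all add: inv_comp permutes_compose permutes_inv permutes_inv_inv comp_assoc)
  have dab: "cayley_dist n a b = r"
    using a b by (simp add: cayley_dist_eq_rank r_def c_def)
  have "inv' a \<circ> ?m = ?k" by (simp add: c_def comp_assoc)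
  then have dam: "cayley_dist n a ?m = r - r div 2"
    using cayley_dist_eq_rank[OF a m] rk by simp
  have "inv' ?m \<circ> b = p" unfolding inv_m using b by (simp add: comp_assoc permutes_inv_o)
  then have dmb: "cayley_dist n ?m b = r div 2"
    using cayley_dist_eq_rank[OF m b] rp by simp
  \<comment> \<open>The left side is \<open>c \<circ> p \<circ> inv' c\<close>. Since
    \<open>c = ?k \<circ> p\<close>, the inner copies of \<open>p\<close> cancel and a conjugate of
    \<open>p\<close> by \<open>?k\<close> is left.\<close>
  have "inv' a \<circ> ?m' = ?k \<circ> p \<circ> inv' ?k"
    using p c by (simp add: c_def[symmetric] inv_comp permutes_inv permutes_inv_inv
        fun_eq_iff permutes_inverses) (simp add: c_def)
  then have dam': "cayley_dist n a ?m' = r div 2"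
    using cayley_dist_eq_rank[OF a m'] rp perm_rank_conj[OF p k] by simp
  have "inv' ?m' \<circ> b = ?k" unfolding inv_m' using b by (simp add: comp_assoc permutes_inv_o)
  then have dmb': "cayley_dist n ?m' b = r - r div 2"
    using cayley_dist_eq_rank[OF m' b] rk by simp
  \<comment> \<open>The two distances are \<open>r - r div 2\<close> and \<open>r div 2\<close>, in
    opposite orders for the two points; they differ by the parity of \<open>r\<close>.\<close>
  have "is_midpoint n a b ?m" "is_midpoint n a b ?m'"
    unfolding is_midpoint_def dab dam dmb dam' dmb' by auto
  then show ?thesis
    using m m' assms(3,4) unfolding midpoint_pair_def midpoint_set_def
    by (auto simp: Let_def c_def[symmetric] p_def[symmetric] sym_group_carrier)
qed

lemma inj_on_midpoint_pair:
  "inj_on (midpoint_pair n) ({a. a permutes {1..n}} \<times> {b. b permutes {1..n}})"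
proof (rule inj_onI, clarify)
  fix a b a' b'
  assume perm: "a permutes {1..n}" "b permutes {1..n}" "a' permutes {1..n}" "b' permutes {1..n}"
    and eq: "midpoint_pair n (a, b) = midpoint_pair n (a', b')"
  define c where "c = inv' a \<circ> b"
  define c' where "c' = inv' a' \<circ> b'"
  have c: "c permutes {1..n}" and c': "c' permutes {1..n}"
    unfolding c_def c'_def by (intro permutes_compose permutes_inv perm)+
  \<comment> \<open>The factors \<open>b\<close> cancel, so the pair of midpoints determines
    \<open>invert_prefix\<close> of \<open>c\<close>.\<close>
  have fold_eq: "inv' (snd (midpoint_pair n (a, b))) \<circ> fst (midpoint_pair n (a, b)) =
      invert_prefix (perm_rank n (inv' a \<circ> b) div 2) n (inv' a \<circ> b)"
    if ab: "a permutes {1..n}" "b permutes {1..n}" for a b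
  proof -
    define c where "c = inv' a \<circ> b"
    define p where "p = half_prefix n c"
    have c: "c permutes {1..n}" unfolding c_def by (intro permutes_compose permutes_inv ab)
    have p: "p permutes {1..n}" unfolding p_def by (rule half_prefix_permutes[OF c])
    have "inv' (b \<circ> p \<circ> inv' c) = c \<circ> inv' p \<circ> inv' b"
      by (rule inv_second_midpoint[OF ab(2) p c])
    then have "inv' (b \<circ> p \<circ> inv' c) \<circ> (b \<circ> inv' p) = c \<circ> inv' p \<circ> inv' p"
      using ab by (simp add: fun_eq_iff permutes_inverses)
    then show ?thesis
      by (simp add: midpoint_pair_def Let_def c_def[symmetric] p_def[symmetric] invert_prefix_def)
        (simp add: p_def half_prefix_def)
  qed
  have f: "invert_prefix (perm_rank n c div 2) n c = invert_prefix (perm_rank n c' div 2) n c'"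
    using fold_eq perm eq unfolding c_def c'_def by metis
  \<comment> \<open>The cut level depends on the unknown permutation; rank invariance shows that
    both sides use the same one, as \<open>invert_prefix_inj\<close> requires.\<close>
  then have "perm_rank n c = perm_rank n c'"
    using perm_rank_invert_prefix c c' by metis
  with f have cc: "c = c'" using invert_prefix_inj c c' by metis
  define p where "p = half_prefix n c"
  have p: "p permutes {1..n}" unfolding p_def by (rule half_prefix_permutes[OF c])
  have "b \<circ> inv' p = b' \<circ> inv' p"
    using eq cc by (simp add: midpoint_pair_def Let_def c_def[symmetric] c'_def[symmetric] p_def)
  then have "b \<circ> inv' p \<circ> p = b' \<circ> inv' p \<circ> p" by simp
  then have bb: "b = b'" using p by (simp add: comp_assoc permutes_inv_o)
  have "inv' a = c \<circ> inv' b" "inv' a' = c' \<circ> inv' b'"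
    using perm by (simp_all add: c_def c'_def comp_assoc permutes_inv_o)
  then have "inv' a = inv' a'" using bb cc by simp
  then have "a = a'" using perm permutes_inv_inv by metis
  with bb show "a = a' \<and> b = b'" by simp
qed

theorem theorem4p1:
  fixes n :: nat and A B :: "(nat \<Rightarrow> nat) set"
  assumes "A \<subseteq> carrier (sym_group n)" and "A \<noteq> {}"
    and "B \<subseteq> carrier (sym_group n)" and "B \<noteq> {}"
  shows "ln (real (card (midpoint_set n A B)))
           \<ge> 1/2 * ln (real (card A)) + 1/2 * ln (real (card B))"
proof -
  let ?M = "midpoint_set n A B"
  have carrier: "carrier (sym_group n) = {p. p permutes {1..n}}"
    by (auto simp: sym_group_carrier)
  have fin: "finite (carrier (sym_group n))"
    by (simp add: carrier finite_permutations)
  have finM: "finite ?M" by (rule finite_subset[OF _ fin]) (auto simp: midpoint_set_def)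
  have "inj_on (midpoint_pair n) (A \<times> B)"
    using assms by (intro inj_on_subset[OF inj_on_midpoint_pair[of n]]) (auto simp: carrier)
  moreover have "midpoint_pair n ` (A \<times> B) \<subseteq> ?M \<times> ?M"
    using midpoint_pair_in_midpoint_set[OF assms(1,3)] by blast
  ultimately have "card (A \<times> B) \<le> card (?M \<times> ?M)"
    using finM by (intro card_inj_on_le) auto
  \<comment> \<open>The inequality to which logarithms are applied; positivity of the three
    cardinalities then justifies monotonicity and additivity of \<open>ln\<close>.\<close>
  then have le: "real (card A) * real (card B) \<le> real (card ?M) * real (card ?M)"
    by (simp add: card_cartesian_product flip: of_nat_mult)
  have pos: "card A > 0" "card B > 0"
    using assms fin by (auto simp: card_gt_0_iff intro: finite_subset)
  with le have posM: "card ?M > 0"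
    by (metis gr0I mult_zero_left not_le of_nat_0 of_nat_0_less_iff mult_pos_pos)
  have "ln (real (card A) * real (card B)) \<le> ln (real (card ?M) * real (card ?M))"
    using le pos posM by (subst ln_le_cancel_iff) auto
  then show ?thesis using pos posM by (simp add: ln_mult)
qed

end
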